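(* Let $a,b,c,d\in\mathbb{R}$ with $ad-bc\neq 0$, put $u=ax+by$, $v=cx+dy$, and let $M$ be the affine translation surface of Type 1 in the isotropic 3-space $\mathbb{I}^3$ parametrized by $$r(x,y)=(r_1,r_2,r_3)(x,y)=\bigl(x,\,y,\,f(u)+g(v)\bigr),$$ with $f,g$ smooth real functions of one variable such that $f''g''\neq0$ everywhere. Suppose there are $\lambda_1,\lambda_2,\lambda_3\in\mathbb{R}$ such that $\bigtriangleup^{II}r_i=\lambda_ir_i$ for $i=1,2,3$. Then $M$ is congruent to one of the following surfaces: (i) $(\lambda_1,\lambda_2,\lambda_3)=(\lambda_1,\lambda_2,0)$ with $\lambda_1\neq0$, $\lambda_2\neq0$, and $$z(x,y)=\ln\Bigl(x^{\frac1{\lambda_1}}y^{\frac1{\lambda_2}}\Bigr)+c_1,\quad c_1\in\mathbb{R};$$ (ii) $(\lambda_1,\lambda_2,\lambda_3)=(\lambda,\lambda,0)$ with $\lambda\neq0$, and $$z(x,y)=\ln\Bigl((uv)^{\frac1\lambda}\Bigr)+c_1,\quad c_1\in\mathbb{R}.$$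
   Context: The isotropic 3-space $\mathbb{I}^3$ is the real affine 3-space with coordinates $(x,y,z)$ endowed with the degenerate metric $ds^2=dx^2+dy^2$. Its group of motions is the six-parameter group of maps $$x'=a_1+x\cos\phi-y\sin\phi,\quad y'=a_2+x\sin\phi+y\cos\phi,\quad z'=a_3+a_4x+a_5y+z,$$ with $a_1,\dots,a_5,\phi\in\mathbb{R}$; two surfaces are congruent if one is carried to the other by such a motion (in particular, equal surfaces are congruent). An affine translation surface of Type 1 is the graph of $z(x,y)=f(ax+by)+g(cx+dy)$ with $ad-bc\ne0$; the pair $(u,v)=(ax+by,cx+dy)$ is called the affine parameter coordinates. Here $f$ and $g$ are smooth functions on open intervals $I$ and $J$, and the graph is taken over $\{(x,y): ax+by\in I,\ cx+dy\in J\}$. Primes denote derivatives of $f$ with respect to $u$ and of $g$ with respect to $v$. The second fundamental form $II$ of a graph surface in $\mathbb{I}^3$ has as matrix the Hessian of $z(x,y)$; the relative curvature is $K=\det$ of this Hessian, which for an affine translation surface equals $(ad-bc)^2f''g''$. The surface is assumed to have no parabolic points, i.e. $K\neq0$ everywhere. The Laplace operator $\bigtriangleup^{II}$ with respect to $II$ (taken with a minus sign) is, for a smooth function $\phi(x,y)$ on $M$, $$\bigtriangleup^{II}\phi=\frac{(f''g'')^{-2}}{2(ad-bc)}\Bigl[(-b\phi_x+a\phi_y)(f'')^2g'''+(d\phi_x-c\phi_y)f'''(g'')^2\Bigr]+\frac{(f''g'')^{-1}}{(ad-bc)^2}\Bigl[(2ab\phi_{xy}-b^2\phi_{xx}-a^2\phi_{yy})f''+(2cd\phi_{xy}-d^2\phi_{xx}-c^2\phi_{yy})g''\Bigr].$$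 The logarithmic expressions are read as real logarithms of absolute values: $\ln(x^{1/\lambda_1}y^{1/\lambda_2})=\frac1{\lambda_1}\ln|x|+\frac1{\lambda_2}\ln|y|$ and $\ln((uv)^{1/\lambda})=\frac1\lambda\ln|uv|$. *)

theory Defs
  imports "HOL-Analysis.Analysis"
begin

text \<open>Smoothness on an open set: derivatives of all orders exist at every point.\<close>

definition smooth_fun_on :: "real set \<Rightarrow> (real \<Rightarrow> real) \<Rightarrow> bool" where
  "smooth_fun_on S f \<longleftrightarrow> (\<forall>k. \<forall>t\<in>S. (deriv ^^ k) f differentiable (at t))"

definition open_interval :: "real set \<Rightarrow> bool" where
  "open_interval I \<longleftrightarrow> open I \<and> is_interval I \<and> I \<noteq> {}"

text \<open>The six-parameter group of motions of isotropic 3-space.\<close>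

definition isotropic_motion :: "(real \<times> real \<times> real \<Rightarrow> real \<times> real \<times> real) \<Rightarrow> bool" where
  "isotropic_motion T \<longleftrightarrow>
     (\<exists>a\<^sub>1 a\<^sub>2 a\<^sub>3 a\<^sub>4 a\<^sub>5 \<phi>. \<forall>x y z. T (x, y, z) =
        (a\<^sub>1 + x * cos \<phi> - y * sin \<phi>,
         a\<^sub>2 + x * sin \<phi> + y * cos \<phi>,
         a\<^sub>3 + a\<^sub>4 * x + a\<^sub>5 * y + z))"

definition isotropic_congruent :: "(real \<times> real \<times> real) set \<Rightarrow> (real \<times> real \<times> real) set \<Rightarrow> bool" where
  "isotropic_congruent S S' \<longleftrightarrow> (\<exists>T. isotropic_motion T \<and> T ` S = S')"

definition graph_surface :: "(real \<times> real) set \<Rightarrow> (real \<Rightarrow> real \<Rightarrow> real) \<Rightarrow> (real \<times> real \<times> real) set" where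
  "graph_surface U z = {(x, y, z x y) | x y. (x, y) \<in> U}"

text \<open>The domain of an affine translation surface of Type 1, whose profile functions live on
  \<open>I\<close> and \<open>J\<close>, and its height function.\<close>

definition ats_domain :: "real \<Rightarrow> real \<Rightarrow> real \<Rightarrow> real \<Rightarrow> real set \<Rightarrow> real set \<Rightarrow> (real \<times> real) set" where
  "ats_domain a b c d I J = {(x, y). a * x + b * y \<in> I \<and> c * x + d * y \<in> J}"

definition ats_height ::
  "real \<Rightarrow> real \<Rightarrow> real \<Rightarrow> real \<Rightarrow> (real \<Rightarrow> real) \<Rightarrow> (real \<Rightarrow> real) \<Rightarrow> real \<Rightarrow> real \<Rightarrow> real" where
  "ats_height a b c d f g x y = f (a * x + b * y) + g (c * x + d * y)"

definition partial_x :: "(real \<Rightarrow> real \<Rightarrow> real) \<Rightarrow> real \<Rightarrow> real \<Rightarrow> real" where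
  "partial_x \<phi> x y = deriv (\<lambda>t. \<phi> t y) x"

definition partial_y :: "(real \<Rightarrow> real \<Rightarrow> real) \<Rightarrow> real \<Rightarrow> real \<Rightarrow> real" where
  "partial_y \<phi> x y = deriv (\<lambda>t. \<phi> x t) y"

text \<open>The Laplace operator (with the sign convention \<open>\<Delta> = - div grad\<close>) of the second fundamental
  form of the affine translation surface \<open>z = f (a x + b y) + g (c x + d y)\<close>, i.e. of the
  pseudo-Riemannian metric whose matrix is the Hessian of \<open>z\<close>, written out in the
  coordinates \<open>x\<close>, \<open>y\<close>. It is meaningful where \<open>f'' g'' \<noteq> 0\<close>.\<close>

definition laplace_II ::
  "real \<Rightarrow> real \<Rightarrow> real \<Rightarrow> real \<Rightarrow> (real \<Rightarrow> real) \<Rightarrow> (real \<Rightarrow> real) \<Rightarrow>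
   (real \<Rightarrow> real \<Rightarrow> real) \<Rightarrow> real \<Rightarrow> real \<Rightarrow> real" where
  "laplace_II a b c d f g \<phi> x y =
    (let u = a * x + b * y; v = c * x + d * y;
         f2 = (deriv ^^ 2) f u; f3 = (deriv ^^ 3) f u;
         g2 = (deriv ^^ 2) g v; g3 = (deriv ^^ 3) g v;
         \<phi>x = partial_x \<phi> x y; \<phi>y = partial_y \<phi> x y;
         \<phi>xx = partial_x (partial_x \<phi>) x y;
         \<phi>xy = partial_y (partial_x \<phi>) x y;
         \<phi>yy = partial_y (partial_y \<phi>) x y
     in inverse ((f2 * g2)\<^sup>2) / (2 * (a * d - b * c)) *
          ((- b * \<phi>x + a * \<phi>y) * f2\<^sup>2 * g3 + (d * \<phi>x - c * \<phi>y) * f3 * g2\<^sup>2)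
        + inverse (f2 * g2) / (a * d - b * c)\<^sup>2 *
          ((2 * a * b * \<phi>xy - b\<^sup>2 * \<phi>xx - a\<^sup>2 * \<phi>yy) * f2
           + (2 * c * d * \<phi>xy - d\<^sup>2 * \<phi>xx - c\<^sup>2 * \<phi>yy) * g2))"

end

theory Submission imports Defs begin

text \<open>
  Write \<open>D = ad - bc\<close>. The equations for \<open>r\<^sub>1\<close> and \<open>r\<^sub>2\<close> are linear in
  \<open>f'''/f''\<^sup>2\<close> and \<open>g'''/g''\<^sup>2\<close>; solving them forces \<open>ab(\<lambda>\<^sub>1 - \<lambda>\<^sub>2) = cd(\<lambda>\<^sub>1 - \<lambda>\<^sub>2) = 0\<close>
  and \<open>f''' = 2\<alpha>u f''\<^sup>2\<close>, \<open>g''' = 2\<beta>v g''\<^sup>2\<close> with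
  \<open>\<alpha> = (\<lambda>\<^sub>1 ad - \<lambda>\<^sub>2 bc)/D\<close> and \<open>\<beta> = (\<lambda>\<^sub>2 ad - \<lambda>\<^sub>1 bc)/D\<close>. The equation for \<open>r\<^sub>3\<close> becomes
  \<open>\<alpha>uf' - \<lambda>\<^sub>3f + \<beta>vg' - \<lambda>\<^sub>3g = 2\<close>, so its variables separate. Differentiating each half and
  combining it with the third-order equation gives \<open>\<lambda>\<^sub>3 = 0\<close> and, unless \<open>\<alpha> = 0\<close>, \<open>\<alpha>uf' = 1\<close>,
  and likewise for \<open>g\<close>; the sum \<open>2\<close> excludes \<open>\<alpha> = 0\<close> and \<open>\<beta> = 0\<close>.
\<close>

section \<open>Calculus of a single profile function\<close>

lemma smooth_fun_on_DERIV:
  assumes "smooth_fun_on S f" "t \<in> S"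
  shows "((deriv ^^ k) f has_real_derivative (deriv ^^ Suc k) f t) (at t)"
  using assms by (auto simp: smooth_fun_on_def DERIV_deriv_iff_real_differentiable)

lemma has_real_derivative_zero_of_const_on:
  fixes h :: "real \<Rightarrow> real"
  assumes "open S" "t \<in> S" "\<And>s. s \<in> S \<Longrightarrow> h s = k" "(h has_real_derivative h') (at t)"
  shows "h' = 0"
proof -
  have "((\<lambda>_. k) has_real_derivative h') (at t)"
    using has_field_derivative_transform_within_open[OF assms(4,1,2)] assms(3) by auto
  then show ?thesis
    using DERIV_unique DERIV_const by blast
qed

text \<open>The identities for \<open>f\<close> and \<open>F\<close> used in the proof are successive derivatives of
  \<open>prof\<close>, simplified with \<open>third\<close>.\<close>

lemma profile_first_derivative:
  fixes f f' F F' :: "real \<Rightarrow> real"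
  assumes "open I" "I \<noteq> {}"
    and f: "\<And>u. u \<in> I \<Longrightarrow> (f has_real_derivative f' u) (at u)"
    and f': "\<And>u. u \<in> I \<Longrightarrow> (f' has_real_derivative F u) (at u)"
    and F: "\<And>u. u \<in> I \<Longrightarrow> (F has_real_derivative F' u) (at u)"
    and nz: "\<And>u. u \<in> I \<Longrightarrow> F u \<noteq> 0"
    and third: "\<And>u. u \<in> I \<Longrightarrow> F' u = 2 * \<alpha> * u * (F u)\<^sup>2"
    and prof: "\<And>u. u \<in> I \<Longrightarrow> \<alpha> * u * f' u - l * f u = m"
  shows "l = 0" "\<alpha> \<noteq> 0 \<Longrightarrow> u \<in> I \<Longrightarrow> \<alpha> * u * f' u = 1"
proof -
  have e1: "\<alpha> * u * F u + \<alpha> * f' u - l * f' u = 0" if "u \<in> I" for u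
  proof (rule has_real_derivative_zero_of_const_on[OF \<open>open I\<close> that prof])
    show "((\<lambda>u. \<alpha> * u * f' u - l * f u) has_real_derivative
        \<alpha> * u * F u + \<alpha> * f' u - l * f' u) (at u)"
      by (auto intro!: derivative_eq_intros f[OF that] f'[OF that])
  qed
  have e2: "2 * \<alpha>\<^sup>2 * u\<^sup>2 * F u = l - 2 * \<alpha>" if "u \<in> I" for u
  proof -
    have "\<alpha> * u * F' u + 2 * \<alpha> * F u - l * F u = 0"
    proof (rule has_real_derivative_zero_of_const_on[OF \<open>open I\<close> that e1])
      show "((\<lambda>u. \<alpha> * u * F u + \<alpha> * f' u - l * f' u) has_real_derivative
          \<alpha> * u * F' u + 2 * \<alpha> * F u - l * F u) (at u)"
        by (auto intro!: derivative_eq_intros f'[OF that] F[OF that])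
    qed
    \<comment> \<open>Substituting \<open>third\<close> makes every term a multiple of
      \<open>F u\<close>, which is nonzero and cancels.\<close>
    then have "F u * (2 * \<alpha>\<^sup>2 * u\<^sup>2 * F u - (l - 2 * \<alpha>)) = 0"
      by (simp add: third[OF that] algebra_simps power2_eq_square)
    then show ?thesis
      using nz[OF that] by simp
  qed
  have e3: "\<alpha>\<^sup>2 * u * F u * (1 + \<alpha> * u\<^sup>2 * F u) = 0" if "u \<in> I" for u
  proof -
    have "4 * \<alpha>\<^sup>2 * u * F u + 2 * \<alpha>\<^sup>2 * u\<^sup>2 * F' u = 0"
    proof (rule has_real_derivative_zero_of_const_on[OF \<open>open I\<close> that e2])
      show "((\<lambda>u. 2 * \<alpha>\<^sup>2 * u\<^sup>2 * F u) has_real_derivative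
          4 * \<alpha>\<^sup>2 * u * F u + 2 * \<alpha>\<^sup>2 * u\<^sup>2 * F' u) (at u)"
        by (auto intro!: derivative_eq_intros F[OF that])
    qed
    then show ?thesis
      by (simp add: third[OF that] algebra_simps power2_eq_square)
  qed
  show l: "l = 0"
  proof (cases "\<alpha> = 0")
    case True
    \<comment> \<open>For \<alpha> = 0 the identity \<open>e1\<close> reads
      \<open>l * f' u = 0\<close>; if \<open>l\<close> were nonzero, \<open>f'\<close> and hence
      \<open>F\<close> would vanish.\<close>
    obtain u where u: "u \<in> I" using \<open>I \<noteq> {}\<close> by blast
    show ?thesis
    proof (rule ccontr)
      assume "l \<noteq> 0"
      with e1 True have "f' t = 0" if "t \<in> I" for t
        using that by simp
      then have "F u = 0"
        using has_real_derivative_zero_of_const_on[OF \<open>open I\<close> u _ f'[OF u]] by blast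
      then show False using nz[OF u] by simp
    qed
  next
    case False
    \<comment> \<open>The identity \<open>e3\<close> carries a factor \<open>u\<close>, so it is
      evaluated at a point other than 0.\<close>
    have "\<not> I \<subseteq> {0}"
      using \<open>open I\<close> \<open>I \<noteq> {}\<close> not_open_singleton by (metis subset_singletonD)
    then obtain u where u: "u \<in> I" "u \<noteq> 0" by blast
    have "1 + \<alpha> * u\<^sup>2 * F u = 0"
      using e3[OF u(1)] False u(2) nz[OF u(1)] by simp
    then have "\<alpha> * u\<^sup>2 * F u = -1" by simp
    then have "2 * \<alpha>\<^sup>2 * u\<^sup>2 * F u = - 2 * \<alpha>"
      by (metis (no_types, lifting) mult.assoc mult.commute mult_minus1_right power2_eq_square mult_minus_left)
    then show ?thesis using e2[OF u(1)] by simp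
  qed
  assume "\<alpha> \<noteq> 0" and u: "u \<in> I"
  \<comment> \<open>With \<open>l = 0\<close>, \<open>e2\<close> fixes \<alpha> * u^2 * F u = -1 at
    every point, which already excludes \<open>u = 0\<close>; multiplying \<open>e1\<close> by
    \<open>u\<close> then yields the claim.\<close>
  have "2 * \<alpha> * (\<alpha> * u\<^sup>2 * F u + 1) = 0"
    using e2[OF u] l by (simp add: algebra_simps power2_eq_square)
  then have "\<alpha> * u\<^sup>2 * F u = -1" using \<open>\<alpha> \<noteq> 0\<close> by (simp add: add_eq_0_iff2)
  moreover have "u * (\<alpha> * u * F u + \<alpha> * f' u) = 0"
    using e1[OF u] l by simp
  ultimately show "\<alpha> * u * f' u = 1"
    by (simp add: algebra_simps power2_eq_square)
qed

text \<open>The equation for \<open>f'\<close> keeps 0 out of \<open>I\<close>, so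
  \<open>ln \<bar>u\<bar>\<close> is differentiable there; the difference of the two primitives has
  zero derivative on an interval and is constant.\<close>

lemma ln_abs_primitive:
  fixes f f' :: "real \<Rightarrow> real"
  assumes "open I" "is_interval I"
    and f: "\<And>u. u \<in> I \<Longrightarrow> (f has_real_derivative f' u) (at u)"
    and f': "\<And>u. u \<in> I \<Longrightarrow> \<alpha> * u * f' u = 1"
  obtains k where "\<And>u. u \<in> I \<Longrightarrow> f u = (1 / \<alpha>) * ln \<bar>u\<bar> + k"
proof -
  have "((\<lambda>u. f u - (1 / \<alpha>) * ln \<bar>u\<bar>) has_real_derivative 0) (at u)" if "u \<in> I" for u
  proof -
    have nz: "u \<noteq> 0" "\<alpha> \<noteq> 0" using f'[OF that] by auto
    have "((\<lambda>u. ln \<bar>u\<bar>) has_real_derivative 1 / u) (at u)"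
    proof (cases "u > 0")
      case True
      show ?thesis
        by (rule has_field_derivative_transform_within_open[where f = ln and S = "{0<..}"])
          (use True in \<open>auto intro!: derivative_eq_intros\<close>)
    next
      case False
      with nz have neg: "u < 0" by simp
      then have "((\<lambda>u. ln (- u)) has_real_derivative 1 / u) (at u)"
        by (auto intro!: derivative_eq_intros)
      then show ?thesis
        by (rule has_field_derivative_transform_within_open[where S = "{..<0}"]) (use neg in auto)
    qed
    from DERIV_diff[OF f[OF that] DERIV_cmult[OF this, of "1 / \<alpha>"]]
    show ?thesis
      using f'[OF that] nz by (simp add: field_simps)
  qed
  then obtain k where "\<And>u. u \<in> I \<Longrightarrow> f u - (1 / \<alpha>) * ln \<bar>u\<bar> = k"
    using has_field_derivative_zero_constant[of I "\<lambda>u. f u - (1 / \<alpha>) * ln \<bar>u\<bar>"] assms(2)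
    by (metis has_field_derivative_at_within is_interval_convex)
  then show thesis
    using that[of k] by (metis add.commute diff_add_cancel)
qed

section \<open>The parameter domain and isotropic congruence\<close>

lemma ats_domain_eq_vimage:
  "ats_domain a b c d I J = (\<lambda>p. (a * fst p + b * snd p, c * fst p + d * snd p)) -` (I \<times> J)"
  by (auto simp: ats_domain_def)

lemma open_ats_domain:
  assumes "open I" "open J"
  shows "open (ats_domain a b c d I J)"
  unfolding ats_domain_eq_vimage
  by (intro open_vimage open_Times assms continuous_intros)

text \<open>The domain is convex, being the preimage of a rectangle under a linear map.\<close>

lemma connected_ats_domain:
  assumes "is_interval I" "is_interval J"
  shows "connected (ats_domain a b c d I J)"
  unfolding ats_domain_eq_vimage
  by (intro convex_connected convex_linear_vimage convex_Times is_interval_convex assms)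
    (auto simp: linear_iff algebra_simps)

text \<open>Cramer's rule. It lets \<open>u\<close> and \<open>v\<close> range independently over
  \<open>I\<close> and \<open>J\<close>, which the separation of variables requires.\<close>

lemma affine_coordinates_inverse:
  fixes a b c d u v :: real
  assumes "a * d - b * c \<noteq> 0"
  obtains x y where "a * x + b * y = u" "c * x + d * y = v"
proof
  have "a * (d * u - b * v) + b * (a * v - c * u) = u * (a * d - b * c)"
    "c * (d * u - b * v) + d * (a * v - c * u) = v * (a * d - b * c)"
    by (simp_all add: algebra_simps)
  then show "a * ((d * u - b * v) / (a * d - b * c)) + b * ((a * v - c * u) / (a * d - b * c)) = u"
    "c * ((d * u - b * v) / (a * d - b * c)) + d * ((a * v - c * u) / (a * d - b * c)) = v"
    using assms by (simp_all flip: add_divide_distrib)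
qed

text \<open>The identity is the motion with all parameters 0. It suffices for the classification,
  where \<open>M\<close> turns out to equal a normal form over its own domain.\<close>

lemma isotropic_congruent_refl: "isotropic_congruent S S"
proof -
  have "isotropic_motion id"
    unfolding isotropic_motion_def by (intro exI[of _ 0]) simp
  then show ?thesis
    unfolding isotropic_congruent_def by (intro exI[of _ id]) simp
qed

lemma graph_surface_cong:
  assumes "\<And>x y. (x, y) \<in> U \<Longrightarrow> z x y = w x y"
  shows "graph_surface U z = graph_surface U w"
  using assms by (auto simp: graph_surface_def)

section \<open>The Laplace operator on the coordinate functions and on the height\<close>

text \<open>Second derivatives of a coordinate function vanish, so only the first-order part of the
  operator survives.\<close>

lemma laplace_II_coordinates:
  "laplace_II a b c d f g (\<lambda>x y. x) x y =
     inverse (((deriv ^^ 2) f (a * x + b * y) * (deriv ^^ 2) g (c * x + d * y))\<^sup>2) / (2 * (a * d - b * c)) *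
       (- b * ((deriv ^^ 2) f (a * x + b * y))\<^sup>2 * (deriv ^^ 3) g (c * x + d * y)
         + d * (deriv ^^ 3) f (a * x + b * y) * ((deriv ^^ 2) g (c * x + d * y))\<^sup>2)"
  "laplace_II a b c d f g (\<lambda>x y. y) x y =
     inverse (((deriv ^^ 2) f (a * x + b * y) * (deriv ^^ 2) g (c * x + d * y))\<^sup>2) / (2 * (a * d - b * c)) *
       (a * ((deriv ^^ 2) f (a * x + b * y))\<^sup>2 * (deriv ^^ 3) g (c * x + d * y)
         - c * (deriv ^^ 3) f (a * x + b * y) * ((deriv ^^ 2) g (c * x + d * y))\<^sup>2)"
  by (simp_all add: laplace_II_def Let_def partial_x_def partial_y_def)

text \<open>Chain rule. Each partial derivative is written again as an \<open>ats_height\<close>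
  with rescaled profiles, so that the lemma can be iterated for second derivatives.\<close>

lemma ats_height_partials:
  assumes "open I" "open J"
    and f: "\<And>u. u \<in> I \<Longrightarrow> (f has_real_derivative f' u) (at u)"
    and g: "\<And>v. v \<in> J \<Longrightarrow> (g has_real_derivative g' v) (at v)"
    and "(x, y) \<in> ats_domain a b c d I J"
  shows "partial_x (ats_height a b c d f g) x y = ats_height a b c d (\<lambda>u. a * f' u) (\<lambda>v. c * g' v) x y"
    and "partial_y (ats_height a b c d f g) x y = ats_height a b c d (\<lambda>u. b * f' u) (\<lambda>v. d * g' v) x y"
proof -
  have uv: "a * x + b * y \<in> I" "c * x + d * y \<in> J"
    using assms(5) by (auto simp: ats_domain_def)
  show "partial_x (ats_height a b c d f g) x y = ats_height a b c d (\<lambda>u. a * f' u) (\<lambda>v. c * g' v) x y"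
    unfolding partial_x_def ats_height_def
    by (rule DERIV_imp_deriv)
      (auto intro!: derivative_eq_intros DERIV_chain'[of _ _ _ _ f] DERIV_chain'[of _ _ _ _ g]
        f[OF uv(1)] g[OF uv(2)])
  show "partial_y (ats_height a b c d f g) x y = ats_height a b c d (\<lambda>u. b * f' u) (\<lambda>v. d * g' v) x y"
    unfolding partial_y_def ats_height_def
    by (rule DERIV_imp_deriv)
      (auto intro!: derivative_eq_intros DERIV_chain'[of _ _ _ _ f] DERIV_chain'[of _ _ _ _ g]
        f[OF uv(1)] g[OF uv(2)])
qed

text \<open>A derivative depends only on the germ. This allows differentiating a first partial whose
  closed form is known only on the domain.\<close>

lemma partials_cong_on_open:
  assumes "open U" "(x, y) \<in> U" "\<And>x y. (x, y) \<in> U \<Longrightarrow> \<phi> x y = \<psi> x y"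
  shows "partial_x \<phi> x y = partial_x \<psi> x y" "partial_y \<phi> x y = partial_y \<psi> x y"
proof -
  have "open ((\<lambda>t. (t, y)) -` U)" "open ((\<lambda>t. (x, t)) -` U)"
    by (intro open_vimage \<open>open U\<close> continuous_intros)+
  then have "\<forall>\<^sub>F t in nhds x. (t, y) \<in> U" "\<forall>\<^sub>F t in nhds y. (x, t) \<in> U"
    using assms(2) by (auto simp: eventually_nhds)
  then have "\<forall>\<^sub>F t in nhds x. \<phi> t y = \<psi> t y" "\<forall>\<^sub>F t in nhds y. \<phi> x t = \<psi> x t"
    by (auto elim!: eventually_mono intro: assms(3))
  then show "partial_x \<phi> x y = partial_x \<psi> x y" "partial_y \<phi> x y = partial_y \<psi> x y"
    unfolding partial_x_def partial_y_def by (auto intro: deriv_cong_ev)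
qed

text \<open>The second-order part is minus the trace of the inverse Hessian times the Hessian, hence
  -2; the fractions come from the first-order part.\<close>

lemma laplace_II_ats_height:
  assumes D: "a * d - b * c \<noteq> 0" and "open I" "open J"
    and smooth: "smooth_fun_on I f" "smooth_fun_on J g"
    and xy: "(x, y) \<in> ats_domain a b c d I J"
    and u: "u = a * x + b * y" and v: "v = c * x + d * y"
    and F: "(deriv ^^ 2) f u \<noteq> 0" and G: "(deriv ^^ 2) g v \<noteq> 0"
  shows "laplace_II a b c d f g (ats_height a b c d f g) x y =
    (deriv f u * (deriv ^^ 3) f u / ((deriv ^^ 2) f u)\<^sup>2
      + deriv g v * (deriv ^^ 3) g v / ((deriv ^^ 2) g v)\<^sup>2) / 2 - 2"
proof -
  define F2 F3 G2 G3 f1 g1 where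
    "F2 = (deriv ^^ 2) f u" and "F3 = (deriv ^^ 3) f u" and
    "G2 = (deriv ^^ 2) g v" and "G3 = (deriv ^^ 3) g v" and
    "f1 = deriv f u" and "g1 = deriv g v"
  note defs = this
  let ?z = "ats_height a b c d f g" and ?U = "ats_domain a b c d I J"
  have f0: "(f has_real_derivative deriv f t) (at t)"
    and f1: "(deriv f has_real_derivative (deriv ^^ 2) f t) (at t)" if "t \<in> I" for t
    using smooth_fun_on_DERIV[OF smooth(1) that, of 0] smooth_fun_on_DERIV[OF smooth(1) that, of 1]
    by (simp_all add: numeral_2_eq_2)
  have g0: "(g has_real_derivative deriv g t) (at t)"
    and g1: "(deriv g has_real_derivative (deriv ^^ 2) g t) (at t)" if "t \<in> J" for t
    using smooth_fun_on_DERIV[OF smooth(2) that, of 0] smooth_fun_on_DERIV[OF smooth(2) that, of 1]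
    by (simp_all add: numeral_2_eq_2)
  have first: "partial_x ?z s t = ats_height a b c d (\<lambda>u. a * deriv f u) (\<lambda>v. c * deriv g v) s t"
    "partial_y ?z s t = ats_height a b c d (\<lambda>u. b * deriv f u) (\<lambda>v. d * deriv g v) s t"
    if "(s, t) \<in> ?U" for s t
    by (rule ats_height_partials[OF assms(2,3) f0 g0 that]; assumption)+
  note cong = partials_cong_on_open[OF open_ats_domain[OF assms(2,3)] xy]
  have second: "partial_x (ats_height a b c d (\<lambda>u. p * deriv f u) (\<lambda>v. q * deriv g v)) x y =
      a * (p * (deriv ^^ 2) f u) + c * (q * (deriv ^^ 2) g v)"
    "partial_y (ats_height a b c d (\<lambda>u. p * deriv f u) (\<lambda>v. q * deriv g v)) x y =
      b * (p * (deriv ^^ 2) f u) + d * (q * (deriv ^^ 2) g v)" for p q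
  proof -
    \<comment> \<open>The same lemma once more, for the profiles \<open>p * deriv f\<close> and
      \<open>q * deriv g\<close>.\<close>
    note second = ats_height_partials[OF assms(2,3) DERIV_cmult[OF f1] DERIV_cmult[OF g1] xy, of p q]
    show "partial_x (ats_height a b c d (\<lambda>u. p * deriv f u) (\<lambda>v. q * deriv g v)) x y =
        a * (p * (deriv ^^ 2) f u) + c * (q * (deriv ^^ 2) g v)"
      by (subst second(1)) (simp_all add: ats_height_def u v)
    show "partial_y (ats_height a b c d (\<lambda>u. p * deriv f u) (\<lambda>v. q * deriv g v)) x y =
        b * (p * (deriv ^^ 2) f u) + d * (q * (deriv ^^ 2) g v)"
      by (subst second(2)) (simp_all add: ats_height_def u v)
  qed
  have px: "partial_x ?z x y = a * f1 + c * g1" and py: "partial_y ?z x y = b * f1 + d * g1"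
    using first[OF xy] by (auto simp: ats_height_def defs u v)
  have pxx: "partial_x (partial_x ?z) x y = a\<^sup>2 * F2 + c\<^sup>2 * G2"
    by (subst cong(1)[OF first(1)], assumption, subst second(1))
      (simp add: defs power2_eq_square)
  have pxy: "partial_y (partial_x ?z) x y = a * b * F2 + c * d * G2"
    by (subst cong(2)[OF first(1)], assumption, subst second(2))
      (simp add: defs power2_eq_square)
  have pyy: "partial_y (partial_y ?z) x y = b\<^sup>2 * F2 + d\<^sup>2 * G2"
    by (subst cong(2)[OF first(2)], assumption, subst second(2))
      (simp add: defs power2_eq_square)
  define E where "E = a * d - b * c"
  have E: "E \<noteq> 0" and FG: "F2 \<noteq> 0" "G2 \<noteq> 0"
    using D F G by (auto simp: E_def defs)
  have "laplace_II a b c d f g ?z x y =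
      inverse ((F2 * G2)\<^sup>2) / (2 * E) *
        ((- b * (a * f1 + c * g1) + a * (b * f1 + d * g1)) * F2\<^sup>2 * G3
          + (d * (a * f1 + c * g1) - c * (b * f1 + d * g1)) * F3 * G2\<^sup>2)
      + inverse (F2 * G2) / E\<^sup>2 *
        ((2 * a * b * (a * b * F2 + c * d * G2) - b\<^sup>2 * (a\<^sup>2 * F2 + c\<^sup>2 * G2) - a\<^sup>2 * (b\<^sup>2 * F2 + d\<^sup>2 * G2)) * F2
          + (2 * c * d * (a * b * F2 + c * d * G2) - d\<^sup>2 * (a\<^sup>2 * F2 + c\<^sup>2 * G2) - c\<^sup>2 * (b\<^sup>2 * F2 + d\<^sup>2 * G2)) * G2)"
    unfolding laplace_II_def Let_def px py pxx pxy pyy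
    by (simp add: defs E_def flip: u v)
  \<comment> \<open>In affine coordinates, -b d/dx + a d/dy is \<open>E\<close> times d/dv, and d
    d/dx - c d/dy is \<open>E\<close> times d/du.\<close>
  also have "- b * (a * f1 + c * g1) + a * (b * f1 + d * g1) = E * g1"
    by (simp add: E_def algebra_simps)
  also have "d * (a * f1 + c * g1) - c * (b * f1 + d * g1) = E * f1"
    by (simp add: E_def algebra_simps)
  \<comment> \<open>This bracket is minus the square of the operator \<open>E\<close> d/dv applied
    to the height; the next one is its analogue for \<open>u\<close>.\<close>
  also have "2 * a * b * (a * b * F2 + c * d * G2) - b\<^sup>2 * (a\<^sup>2 * F2 + c\<^sup>2 * G2) - a\<^sup>2 * (b\<^sup>2 * F2 + d\<^sup>2 * G2)
      = - (E\<^sup>2 * G2)"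
    by (simp add: E_def algebra_simps power2_eq_square)
  also have "2 * c * d * (a * b * F2 + c * d * G2) - d\<^sup>2 * (a\<^sup>2 * F2 + c\<^sup>2 * G2) - c\<^sup>2 * (b\<^sup>2 * F2 + d\<^sup>2 * G2)
      = - (E\<^sup>2 * F2)"
    by (simp add: E_def algebra_simps power2_eq_square)
  also have "inverse ((F2 * G2)\<^sup>2) / (2 * E) * (E * g1 * F2\<^sup>2 * G3 + E * f1 * F3 * G2\<^sup>2)
      + inverse (F2 * G2) / E\<^sup>2 * (- (E\<^sup>2 * G2) * F2 + - (E\<^sup>2 * F2) * G2)
      = (f1 * F3 / F2\<^sup>2 + g1 * G3 / G2\<^sup>2) / 2 - 2"
    using E FG by (simp add: field_simps power2_eq_square)
  finally show ?thesis by (simp add: defs)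
qed

section \<open>Separating the coordinate equations\<close>

text \<open>Up to the factor 2(ad - bc), the two equations form a linear system in the fractions
  \<open>P\<close> and \<open>Q\<close> with determinant ad - bc. Eliminating one unknown and using
  (ad - bc)x = du - bv, (ad - bc)y = av - cu gives the result.\<close>

lemma coordinate_equations_solved:
  assumes D: "a * d - b * c \<noteq> 0"
    and u: "u = a * x + b * y" and v: "v = c * x + d * y"
    and F: "(deriv ^^ 2) f u \<noteq> 0" and G: "(deriv ^^ 2) g v \<noteq> 0"
    and l1: "laplace_II a b c d f g (\<lambda>x y. x) x y = l\<^sub>1 * x"
    and l2: "laplace_II a b c d f g (\<lambda>x y. y) x y = l\<^sub>2 * y"
  shows "(a * d - b * c) * ((deriv ^^ 3) f u / ((deriv ^^ 2) f u)\<^sup>2) =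
      2 * (l\<^sub>1 * (a * d) - l\<^sub>2 * (b * c)) * u + 2 * (a * b) * (l\<^sub>2 - l\<^sub>1) * v"
    and "(a * d - b * c) * ((deriv ^^ 3) g v / ((deriv ^^ 2) g v)\<^sup>2) =
      2 * (c * d) * (l\<^sub>1 - l\<^sub>2) * u + 2 * (l\<^sub>2 * (a * d) - l\<^sub>1 * (b * c)) * v"
proof -
  define P Q where "P = (deriv ^^ 3) f u / ((deriv ^^ 2) f u)\<^sup>2"
    and "Q = (deriv ^^ 3) g v / ((deriv ^^ 2) g v)\<^sup>2"
  have e1: "d * P - b * Q = 2 * (a * d - b * c) * (l\<^sub>1 * x)"
    unfolding l1[symmetric] laplace_II_coordinates(1) u[symmetric] v[symmetric] P_def Q_def
    using D F G by (simp add: divide_simps)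
  have e2: "a * Q - c * P = 2 * (a * d - b * c) * (l\<^sub>2 * y)"
    unfolding l2[symmetric] laplace_II_coordinates(2) u[symmetric] v[symmetric] P_def Q_def
    using D F G by (simp add: divide_simps)
  have "(a * d - b * c) * P = a * (d * P - b * Q) + b * (a * Q - c * P)"
    by (simp add: algebra_simps)
  also have "\<dots> = 2 * (l\<^sub>1 * (a * d) - l\<^sub>2 * (b * c)) * u + 2 * (a * b) * (l\<^sub>2 - l\<^sub>1) * v"
    unfolding e1 e2 u v by (simp add: algebra_simps)
  finally show "(a * d - b * c) * P = \<dots>" .
  have "(a * d - b * c) * Q = c * (d * P - b * Q) + d * (a * Q - c * P)"
    by (simp add: algebra_simps)
  also have "\<dots> = 2 * (c * d) * (l\<^sub>1 - l\<^sub>2) * u + 2 * (l\<^sub>2 * (a * d) - l\<^sub>1 * (b * c)) * v"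
    unfolding e1 e2 u v by (simp add: algebra_simps)
  finally show "(a * d - b * c) * Q = \<dots>" .
qed

text \<open>Differentiation in \<open>t\<close>. With one of \<open>u\<close>, \<open>v\<close>
  frozen, it removes the mixed terms of the solved coordinate equations.\<close>

lemma slope_zero_of_independent:
  fixes k :: real
  assumes "open S" "S \<noteq> {}" "\<And>t. t \<in> S \<Longrightarrow> p = q + k * t"
  shows "k = 0"
proof -
  obtain t where t: "t \<in> S" using assms(2) by blast
  show ?thesis
    by (rule has_real_derivative_zero_of_const_on[OF assms(1) t, of "\<lambda>t. q + k * t" p])
      (auto intro!: derivative_eq_intros simp flip: assms(3))
qed

section \<open>The classification\<close>

theorem theorem4p2:
  fixes a b c d l\<^sub>1 l\<^sub>2 l\<^sub>3 :: real
    and f g :: "real \<Rightarrow> real"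
    and I J :: "real set"
    and M :: "(real \<times> real \<times> real) set"
  assumes "a * d - b * c \<noteq> 0"
    and "open_interval I" and "open_interval J"
    and "smooth_fun_on I f" and "smooth_fun_on J g"
    and "\<forall>u\<in>I. \<forall>v\<in>J. (deriv ^^ 2) f u * (deriv ^^ 2) g v \<noteq> 0"
    and "M = graph_surface (ats_domain a b c d I J) (ats_height a b c d f g)"
    and "\<forall>(x, y) \<in> ats_domain a b c d I J.
           laplace_II a b c d f g (\<lambda>x y. x) x y = l\<^sub>1 * x"
    and "\<forall>(x, y) \<in> ats_domain a b c d I J.
           laplace_II a b c d f g (\<lambda>x y. y) x y = l\<^sub>2 * y"
    and "\<forall>(x, y) \<in> ats_domain a b c d I J.
           laplace_II a b c d f g (ats_height a b c d f g) x y = l\<^sub>3 * ats_height a b c d f g x y"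
  shows
    "(l\<^sub>1 \<noteq> 0 \<and> l\<^sub>2 \<noteq> 0 \<and> l\<^sub>3 = 0 \<and>
       (\<exists>c\<^sub>1 U. open U \<and> connected U \<and> U \<noteq> {} \<and> U \<subseteq> {(x, y). x \<noteq> 0 \<and> y \<noteq> 0} \<and>
          isotropic_congruent M
            (graph_surface U (\<lambda>x y. (1 / l\<^sub>1) * ln \<bar>x\<bar> + (1 / l\<^sub>2) * ln \<bar>y\<bar> + c\<^sub>1))))
     \<or>
     (\<exists>l. l \<noteq> 0 \<and> l\<^sub>1 = l \<and> l\<^sub>2 = l \<and> l\<^sub>3 = 0 \<and>
       (\<exists>c\<^sub>1 U. open U \<and> connected U \<and> U \<noteq> {} \<and>
          U \<subseteq> {(x, y). a * x + b * y \<noteq> 0 \<and> c * x + d * y \<noteq> 0} \<and>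
          isotropic_congruent M
            (graph_surface U (\<lambda>x y. (1 / l) * ln \<bar>(a * x + b * y) * (c * x + d * y)\<bar> + c\<^sub>1))))"
proof -
  note D = assms(1)
  have I: "open I" "is_interval I" "I \<noteq> {}" and J: "open J" "is_interval J" "J \<noteq> {}"
    using assms(2,3) by (auto simp: open_interval_def)
  define f1 F F' g1 G G' where
    "f1 = deriv f" and "F = (deriv ^^ 2) f" and "F' = (deriv ^^ 3) f" and
    "g1 = deriv g" and "G = (deriv ^^ 2) g" and "G' = (deriv ^^ 3) g"
  note defs = this
  have df: "(f has_real_derivative f1 u) (at u)" "(f1 has_real_derivative F u) (at u)"
    "(F has_real_derivative F' u) (at u)" if "u \<in> I" for u
    using smooth_fun_on_DERIV[OF assms(4) that, of 0] smooth_fun_on_DERIV[OF assms(4) that, of 1]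
      smooth_fun_on_DERIV[OF assms(4) that, of 2]
    by (simp_all add: defs numeral_2_eq_2 numeral_3_eq_3)
  have dg: "(g has_real_derivative g1 v) (at v)" "(g1 has_real_derivative G v) (at v)"
    "(G has_real_derivative G' v) (at v)" if "v \<in> J" for v
    using smooth_fun_on_DERIV[OF assms(5) that, of 0] smooth_fun_on_DERIV[OF assms(5) that, of 1]
      smooth_fun_on_DERIV[OF assms(5) that, of 2]
    by (simp_all add: defs numeral_2_eq_2 numeral_3_eq_3)
  have Fnz: "F u \<noteq> 0" if "u \<in> I" for u
    using assms(6) that J(3) by (auto simp: defs)
  have Gnz: "G v \<noteq> 0" if "v \<in> J" for v
    using assms(6) that I(3) by (auto simp: defs)
  let ?U = "ats_domain a b c d I J"
  define E where "E = a * d - b * c"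
  define \<alpha> \<beta> where "\<alpha> = (l\<^sub>1 * (a * d) - l\<^sub>2 * (b * c)) / E"
    and "\<beta> = (l\<^sub>2 * (a * d) - l\<^sub>1 * (b * c)) / E"
  have E: "E \<noteq> 0" using D by (simp add: E_def)
  have eqs: "E * (F' u / (F u)\<^sup>2) = 2 * E * \<alpha> * u + 2 * (a * b) * (l\<^sub>2 - l\<^sub>1) * v"
    "E * (G' v / (G v)\<^sup>2) = 2 * E * \<beta> * v + 2 * (c * d) * (l\<^sub>1 - l\<^sub>2) * u"
    "(f1 u * (F' u / (F u)\<^sup>2) + g1 v * (G' v / (G v)\<^sup>2)) / 2 - 2 = l\<^sub>3 * (f u + g v)"
    if uv: "u \<in> I" "v \<in> J" for u v
  proof -
    obtain x y where xy: "a * x + b * y = u" "c * x + d * y = v"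
      using affine_coordinates_inverse[OF D] by blast
    then have dom: "(x, y) \<in> ?U" using uv by (simp add: ats_domain_def)
    note nz = Fnz[OF uv(1), unfolded defs] Gnz[OF uv(2), unfolded defs]
    have "laplace_II a b c d f g (\<lambda>x y. x) x y = l\<^sub>1 * x" "laplace_II a b c d f g (\<lambda>x y. y) x y = l\<^sub>2 * y"
      using assms(8,9) dom by auto
    note c = coordinate_equations_solved[OF D xy[symmetric] nz this, folded E_def defs]
    have slopes: "l\<^sub>1 * (a * d) - l\<^sub>2 * (b * c) = E * \<alpha>" "l\<^sub>2 * (a * d) - l\<^sub>1 * (b * c) = E * \<beta>"
      using E by (simp_all add: \<alpha>_def \<beta>_def)
    show "E * (F' u / (F u)\<^sup>2) = 2 * E * \<alpha> * u + 2 * (a * b) * (l\<^sub>2 - l\<^sub>1) * v"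
      using c(1) by (simp only: slopes mult.assoc)
    show "E * (G' v / (G v)\<^sup>2) = 2 * E * \<beta> * v + 2 * (c * d) * (l\<^sub>1 - l\<^sub>2) * u"
      using c(2) by (simp only: slopes mult.assoc add.commute)
    show "(f1 u * (F' u / (F u)\<^sup>2) + g1 v * (G' v / (G v)\<^sup>2)) / 2 - 2 = l\<^sub>3 * (f u + g v)"
      using laplace_II_ats_height[OF D I(1) J(1) assms(4,5) dom xy[symmetric] nz] assms(10) dom xy
      by (auto simp: defs ats_height_def)
  qed
  obtain u0 v0 where uv0: "u0 \<in> I" "v0 \<in> J" using I(3) J(3) by blast
  \<comment> \<open>At fixed \<open>u0\<close> the left side of \<open>eqs(1)\<close> does not
    depend on \<open>v\<close>, so the coefficient of \<open>v\<close> vanishes.\<close>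
  have "2 * (a * b) * (l\<^sub>2 - l\<^sub>1) = 0"
    by (rule slope_zero_of_independent[OF J(1,3) eqs(1)[OF uv0(1)]])
  then have ab: "a * b * (l\<^sub>2 - l\<^sub>1) = 0" by simp
  have "2 * (c * d) * (l\<^sub>1 - l\<^sub>2) = 0"
    by (rule slope_zero_of_independent[OF I(1,3) eqs(2)[OF _ uv0(2)]])
  then have cd: "c * d * (l\<^sub>1 - l\<^sub>2) = 0" by simp
  have P: "F' u / (F u)\<^sup>2 = 2 * \<alpha> * u" if "u \<in> I" for u
  proof -
    have "E * (F' u / (F u)\<^sup>2) = E * (2 * \<alpha> * u)"
      using eqs(1)[OF that uv0(2)] ab by auto
    then show ?thesis using E by (metis mult_left_cancel)
  qed
  have Q: "G' v / (G v)\<^sup>2 = 2 * \<beta> * v" if "v \<in> J" for v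
  proof -
    have "E * (G' v / (G v)\<^sup>2) = E * (2 * \<beta> * v)"
      using eqs(2)[OF uv0(1) that] cd by auto
    then show ?thesis using E by (metis mult_left_cancel)
  qed
  have F3: "F' u = 2 * \<alpha> * u * (F u)\<^sup>2" if "u \<in> I" for u
    using P[OF that] Fnz[OF that] by (simp add: field_simps)
  have G3: "G' v = 2 * \<beta> * v * (G v)\<^sup>2" if "v \<in> J" for v
    using Q[OF that] Gnz[OF that] by (simp add: field_simps)
  have sum: "(\<alpha> * u * f1 u - l\<^sub>3 * f u) + (\<beta> * v * g1 v - l\<^sub>3 * g v) = 2"
    if "u \<in> I" "v \<in> J" for u v
    using eqs(3)[OF that] P[OF that(1)] Q[OF that(2)] by (simp add: algebra_simps)
  \<comment> \<open>Freezing \<open>v0\<close> turns the \<open>g\<close> half into the constant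
    \<open>m\<close> of the profile equation, with \<open>l\<^sub>3\<close> as
    \<open>l\<close>.\<close>
  have sepf: "\<alpha> * u * f1 u - l\<^sub>3 * f u = 2 - (\<beta> * v0 * g1 v0 - l\<^sub>3 * g v0)" if "u \<in> I" for u
    using sum[OF that uv0(2)] by simp
  have sepg: "\<beta> * v * g1 v - l\<^sub>3 * g v = 2 - (\<alpha> * u0 * f1 u0 - l\<^sub>3 * f u0)" if "v \<in> J" for v
    using sum[OF uv0(1) that] by simp
  have l3: "l\<^sub>3 = 0"
    by (rule profile_first_derivative(1)[OF I(1,3) df Fnz F3 sepf])
  have proff: "\<alpha> * u * f1 u = 1" if "\<alpha> \<noteq> 0" "u \<in> I" for u
    by (rule profile_first_derivative(2)[OF I(1,3) df Fnz F3 sepf that])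
  have profg: "\<beta> * v * g1 v = 1" if "\<beta> \<noteq> 0" "v \<in> J" for v
    by (rule profile_first_derivative(2)[OF J(1,3) dg Gnz G3 sepg that])
  \<comment> \<open>Since \<open>l\<^sub>3 = 0\<close>, each half of \<open>sum\<close> is 0 or 1
    according to whether its coefficient vanishes; a total of 2 needs both to be 1.\<close>
  have \<alpha>\<beta>: "\<alpha> \<noteq> 0" "\<beta> \<noteq> 0"
    using sum[OF uv0] l3 proff[OF _ uv0(1)] profg[OF _ uv0(2)] by fastforce+
  note f1 = proff[OF \<alpha>\<beta>(1)] and g1 = profg[OF \<alpha>\<beta>(2)]
  obtain kf where kf: "\<And>u. u \<in> I \<Longrightarrow> f u = (1 / \<alpha>) * ln \<bar>u\<bar> + kf"
    using ln_abs_primitive[OF I(1,2) df(1) f1] by blast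
  obtain kg where kg: "\<And>v. v \<in> J \<Longrightarrow> g v = (1 / \<beta>) * ln \<bar>v\<bar> + kg"
    using ln_abs_primitive[OF J(1,2) dg(1) g1] by blast
  have nz: "a * x + b * y \<noteq> 0" "c * x + d * y \<noteq> 0" if "(x, y) \<in> ?U" for x y
    using that f1[of "a * x + b * y"] g1[of "c * x + d * y"] by (auto simp: ats_domain_def)
  have height: "ats_height a b c d f g x y =
      (1 / \<alpha>) * ln \<bar>a * x + b * y\<bar> + (1 / \<beta>) * ln \<bar>c * x + d * y\<bar> + (kf + kg)"
    if "(x, y) \<in> ?U" for x y
    using that kf kg by (simp add: ats_height_def ats_domain_def)
  have U: "open ?U" "connected ?U"
    using open_ats_domain[OF I(1) J(1)] connected_ats_domain[OF I(2) J(2)] by auto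
  obtain x0 y0 where "a * x0 + b * y0 = u0" "c * x0 + d * y0 = v0"
    using affine_coordinates_inverse[OF D] by blast
  then have Une: "?U \<noteq> {}" using uv0 by (auto simp: ats_domain_def)
  have congruent: "isotropic_congruent M (graph_surface ?U z)"
    if "\<And>x y. (x, y) \<in> ?U \<Longrightarrow> ats_height a b c d f g x y = z x y" for z
    using graph_surface_cong[OF that] isotropic_congruent_refl assms(7) by simp
  show ?thesis
  proof (cases "l\<^sub>1 = l\<^sub>2")
    case True
    have "l\<^sub>1 * (a * d) - l\<^sub>1 * (b * c) = l\<^sub>1 * E" by (simp add: E_def algebra_simps)
    \<comment> \<open>Equal eigenvalues factor out of \<alpha> and \<beta>, leaving
      \<open>E / E\<close>; the two logarithms then share one coefficient and merge into that of the
      product.\<close>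
    then have eq: "\<alpha> = l\<^sub>1" "\<beta> = l\<^sub>1" using True E by (auto simp: \<alpha>_def \<beta>_def)
    have "isotropic_congruent M (graph_surface ?U
        (\<lambda>x y. (1 / l\<^sub>1) * ln \<bar>(a * x + b * y) * (c * x + d * y)\<bar> + (kf + kg)))"
      by (rule congruent) (use height nz in \<open>simp add: eq abs_mult ln_mult add_divide_distrib\<close>)
    moreover have "?U \<subseteq> {(x, y). a * x + b * y \<noteq> 0 \<and> c * x + d * y \<noteq> 0}"
      using nz by blast
    ultimately show ?thesis
      using True \<alpha>\<beta> eq l3 U Une by blast
  next
    case False
    then have abcd: "a * b = 0" "c * d = 0" using ab cd by auto
    \<comment> \<open>The coordinate change is diagonal or antidiagonal: any other vanishing pattern
      makes ad - bc zero.\<close>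
    then consider "b = 0" "c = 0" "a \<noteq> 0" "d \<noteq> 0" | "a = 0" "d = 0" "b \<noteq> 0" "c \<noteq> 0"
      using D by auto
    then have "\<exists>k. ?U \<subseteq> {(x, y). x \<noteq> 0 \<and> y \<noteq> 0} \<and> l\<^sub>1 \<noteq> 0 \<and> l\<^sub>2 \<noteq> 0 \<and>
        (\<forall>(x, y) \<in> ?U. ats_height a b c d f g x y = (1 / l\<^sub>1) * ln \<bar>x\<bar> + (1 / l\<^sub>2) * ln \<bar>y\<bar> + k)"
    proof cases
      case 1
      then have eq: "\<alpha> = l\<^sub>1" "\<beta> = l\<^sub>2" using E by (auto simp: \<alpha>_def \<beta>_def E_def)
      have sub: "x \<noteq> 0 \<and> y \<noteq> 0" if "(x, y) \<in> ?U" for x y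
        using nz[OF that] 1 by auto
      \<comment> \<open>Here \<open>u = a * x\<close> and \<open>v = d * y\<close>; the logarithms
        of the scale factors go into the constant.\<close>
      have "ats_height a b c d f g x y = (1 / l\<^sub>1) * ln \<bar>x\<bar> + (1 / l\<^sub>2) * ln \<bar>y\<bar>
          + ((1 / l\<^sub>1) * ln \<bar>a\<bar> + (1 / l\<^sub>2) * ln \<bar>d\<bar> + (kf + kg))" if "(x, y) \<in> ?U" for x y
        using height[OF that] sub[OF that] 1
        by (simp add: eq abs_mult ln_mult add_divide_distrib)
      then show ?thesis using sub \<alpha>\<beta> eq by blast
    next
      case 2
      \<comment> \<open>Now \<open>u = b * y\<close> and \<open>v = c * x\<close>, so
        \<open>f\<close> carries the eigenvalue of \<open>y\<close> and \<open>g\<close> that of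
        \<open>x\<close>.\<close>
      then have eq: "\<alpha> = l\<^sub>2" "\<beta> = l\<^sub>1" using E by (auto simp: \<alpha>_def \<beta>_def E_def)
      have sub: "x \<noteq> 0 \<and> y \<noteq> 0" if "(x, y) \<in> ?U" for x y
        using nz[OF that] 2 by auto
      have "ats_height a b c d f g x y = (1 / l\<^sub>1) * ln \<bar>x\<bar> + (1 / l\<^sub>2) * ln \<bar>y\<bar>
          + ((1 / l\<^sub>1) * ln \<bar>c\<bar> + (1 / l\<^sub>2) * ln \<bar>b\<bar> + (kf + kg))" if "(x, y) \<in> ?U" for x y
        using height[OF that] sub[OF that] 2
        by (simp add: eq abs_mult ln_mult add_divide_distrib)
      then show ?thesis using sub \<alpha>\<beta> eq by blast
    qed
    then obtain k where k: "?U \<subseteq> {(x, y). x \<noteq> 0 \<and> y \<noteq> 0}" "l\<^sub>1 \<noteq> 0" "l\<^sub>2 \<noteq> 0"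
      "\<And>x y. (x, y) \<in> ?U \<Longrightarrow> ats_height a b c d f g x y = (1 / l\<^sub>1) * ln \<bar>x\<bar> + (1 / l\<^sub>2) * ln \<bar>y\<bar> + k"
      by blast
    then show ?thesis
      using congruent[OF k(4)] l3 U Une by blast
  qed
qed

end
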